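(* Let $p\ge 1$ be an integer, let $n_1,\dots,n_p$ be positive integers, and let $s_p=n_1n_2\cdots n_p$. Let $T^{(p)}$ be a $p$-level Toeplitz matrix of size $s_p\times s_p$ with level sizes $n_1,\dots,n_p$. For $i=1,\dots,p$ let $$U_i=I_{n_p}\otimes I_{n_{p-1}}\otimes\cdots\otimes I_{n_{i+1}}\otimes U(n_i)\otimes I_{n_{i-1}}\otimes\cdots\otimes I_{n_2}\otimes I_{n_1},$$ and let $U=U_1\cdots U_{p-1}U_p$. Then $U$ is a unitary matrix of size $s_p\times s_p$ and $U^*T^{(p)}U$ is symmetric.
   Context: All matrices are complex; $I_n$ is the $n\times n$ identity matrix, $\otimes$ is the Kronecker product, $U^*$ is the conjugate transpose, and "symmetric" means equal to its (non-conjugate) transpose. Multilevel Toeplitz matrices. A $0$-level Toeplitz matrix is a complex number. For $p\ge1$ and positive integers $n_1,\dots,n_p$, put $s_0=1$ and $s_k=n_1\cdots n_k$. A $p$-level Toeplitz matrix with level sizes $n_1,\dots,n_p$ is an $s_p\times s_p$ matrix that, viewed as an $n_p\times n_p$ block matrix with blocks of size $s_{p-1}\times s_{p-1}$, has $(i,j)$ block equal to $T^{(p-1)}_{i-j}$ for $1\le i,j\le n_p$, where each $T^{(p-1)}_{l}$ ($|l|\le n_p-1$) is a $(p-1)$-level Toeplitz matrix with level sizes $n_1,\dots,n_{p-1}$. (A $1$-level Toeplitz matrix is an ordinary Toeplitz matrix.) The matrices $U(n)$. In the following, $\mathrm{i}=\sqrt{-1}$. For $n=2m$ even, $m\geq 1$,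 $U(n)$ is the $n\times n$ matrix whose entries are: for $1\le j\le m$, $U(n)_{j,j}=\frac1{\sqrt2}$, $U(n)_{j,n+1-j}=\frac{\mathrm{i}}{\sqrt2}$, $U(n)_{n+1-j,j}=\frac1{\sqrt2}$, $U(n)_{n+1-j,n+1-j}=-\frac{\mathrm{i}}{\sqrt2}$; all other entries are $0$. For $n=2m+1$ odd, $U(n)$ has the same entries for $1\le j\le m$, together with $U(n)_{m+1,m+1}=1$; all other entries are $0$. In particular $U(1)=(1)$. *)

theory Defs
  imports "Jordan_Normal_Form.Schur_Decomposition"
begin

text \<open>
  Matrix entries are indexed from 0, so the mathematical entry \<open>(i, j)\<close> is \<open>A $$ (i - 1, j - 1)\<close>.
  Level sizes are a function \<open>n\<close> of which only \<open>n 1, \<dots>, n p\<close> matter; levels are numbered from 1.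
\<close>

definition unitary_mat :: "nat \<Rightarrow> complex mat \<Rightarrow> bool" where
  "unitary_mat N A \<longleftrightarrow>
     A \<in> carrier_mat N N \<and> mat_adjoint A * A = 1\<^sub>m N \<and> A * mat_adjoint A = 1\<^sub>m N"

definition symmetric_mat :: "'a mat \<Rightarrow> bool" where
  "symmetric_mat A \<longleftrightarrow> transpose_mat A = A"

definition kronecker :: "'a::times mat \<Rightarrow> 'a mat \<Rightarrow> 'a mat" where
  "kronecker A B = mat (dim_row A * dim_row B) (dim_col A * dim_col B)
     (\<lambda>(i, j). A $$ (i div dim_row B, j div dim_col B) * B $$ (i mod dim_row B, j mod dim_col B))"

definition total_size :: "(nat \<Rightarrow> nat) \<Rightarrow> nat \<Rightarrow> nat" where
  "total_size n k = (\<Prod>i = 1..k. n i)"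

definition mat_block :: "nat \<Rightarrow> 'a mat \<Rightarrow> nat \<Rightarrow> nat \<Rightarrow> 'a mat" where
  "mat_block b A i j = mat b b (\<lambda>(r, c). A $$ (i * b + r, j * b + c))"

text \<open>A 0-level Toeplitz matrix, i.e. a complex number, is represented as a 1 by 1 matrix.\<close>

fun multilevel_toeplitz :: "(nat \<Rightarrow> nat) \<Rightarrow> nat \<Rightarrow> complex mat \<Rightarrow> bool" where
  "multilevel_toeplitz n 0 A \<longleftrightarrow> A \<in> carrier_mat 1 1"
| "multilevel_toeplitz n (Suc k) A \<longleftrightarrow>
     A \<in> carrier_mat (total_size n (Suc k)) (total_size n (Suc k)) \<and>
     (\<exists>T :: int \<Rightarrow> complex mat.
        (\<forall>l. \<bar>l\<bar> \<le> int (n (Suc k)) - 1 \<longrightarrow> multilevel_toeplitz n k (T l)) \<and>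
        (\<forall>i < n (Suc k). \<forall>j < n (Suc k).
           mat_block (total_size n k) A i j = T (int i - int j)))"

text \<open>
  With 0-based indices the index opposite to \<open>j\<close> (mathematically \<open>n + 1 - j\<close>) is \<open>n - 1 - j\<close>,
  and \<open>1 \<le> j \<le> m\<close> becomes \<open>j < n div 2\<close>.
\<close>

definition U_mat :: "nat \<Rightarrow> complex mat" where
  "U_mat n = mat n n (\<lambda>(r, c).
     if r < n div 2 \<and> c = r then 1 / complex_of_real (sqrt 2)
     else if r < n div 2 \<and> c = n - 1 - r then \<i> / complex_of_real (sqrt 2)
     else if c < n div 2 \<and> r = n - 1 - c then 1 / complex_of_real (sqrt 2)
     else if n - 1 - r < n div 2 \<and> c = r then - \<i> / complex_of_real (sqrt 2)
     else if odd n \<and> r = n div 2 \<and> c = r then 1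
     else 0)"

text \<open>
  The Kronecker product runs from level \<open>p\<close> (leftmost) down to level 1 (rightmost); the start
  value \<open>1\<^sub>m 1\<close> is its neutral element.
\<close>

definition U_factor :: "(nat \<Rightarrow> nat) \<Rightarrow> nat \<Rightarrow> nat \<Rightarrow> complex mat" where
  "U_factor n p i =
     foldr kronecker (map (\<lambda>k. if k = i then U_mat (n k) else 1\<^sub>m (n k)) (rev [1..<Suc p])) (1\<^sub>m 1)"

definition U_total :: "(nat \<Rightarrow> nat) \<Rightarrow> nat \<Rightarrow> complex mat" where
  "U_total n p = foldr (*) (map (U_factor n p) [1..<Suc p]) (1\<^sub>m (total_size n p))"

end

theory Submission
  imports Defs
begin

text \<open>
  Let \<open>J\<close> be the exchange matrix. A multilevel Toeplitz matrix satisfies \<open>J T\<^sup>t = T J\<close>, since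
  reversing the indices at every level negates each difference of indices. On the other hand
  \<open>U(n) U(n)\<^sup>t = J\<close>, and both this identity and unitarity pass to Kronecker products, where \<open>U\<close> is
  the Kronecker product of the \<open>U(n\<^sub>i)\<close>. Hence
  \<open>(U\<^sup>* T U)\<^sup>t = U\<^sup>* J T\<^sup>t (U\<^sup>*)\<^sup>t = U\<^sup>* T J (U\<^sup>*)\<^sup>t = U\<^sup>* T U\<close>.
\<close>

section \<open>Adjoints and Kronecker products\<close>

lemma index_mat_adjoint [simp]:
  assumes "i < dim_col A" "j < dim_row A"
  shows "mat_adjoint A $$ (i, j) = conjugate (A $$ (j, i))"
  using assms by (simp add: mat_adjoint_def mat_of_rows_def)

lemma dim_mat_adjoint [simp]:
  "dim_row (mat_adjoint A) = dim_col A" "dim_col (mat_adjoint A) = dim_row A"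
  by (simp_all add: mat_adjoint_def)

lemma dim_kronecker [simp]:
  "dim_row (kronecker A B) = dim_row A * dim_row B"
  "dim_col (kronecker A B) = dim_col A * dim_col B"
  by (simp_all add: kronecker_def)

lemma kronecker_carrier:
  "A \<in> carrier_mat a b \<Longrightarrow> B \<in> carrier_mat c d \<Longrightarrow> kronecker A B \<in> carrier_mat (a * c) (b * d)"
  by auto

lemma div_mod_less_mult:
  fixes i a b :: nat
  assumes "i < a * b"
  shows "i div b < a" "i mod b < b" "0 < b"
  using assms by (auto simp: less_mult_imp_div_less intro!: mod_less_divisor gr0I)

lemma index_kronecker:
  assumes "i < dim_row A * dim_row B" "j < dim_col A * dim_col B"
  shows "kronecker A B $$ (i, j) =
    A $$ (i div dim_row B, j div dim_col B) * B $$ (i mod dim_row B, j mod dim_col B)"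
  using assms by (simp add: kronecker_def)

text \<open>The range below \<open>p * q\<close> is cut into \<open>p\<close> consecutive runs of
  length \<open>q\<close>; quotient and remainder give the run and the position in it. This splits
  the contracted index in a product of Kronecker products.\<close>

lemma sum_div_mod:
  fixes f :: "nat \<Rightarrow> nat \<Rightarrow> 'a::comm_monoid_add"
  shows "(\<Sum>k = 0..<p * q. f (k div q) (k mod q)) = (\<Sum>x = 0..<p. \<Sum>y = 0..<q. f x y)"
proof -
  have "(\<Sum>k = 0..<p * q. f (k div q) (k mod q))
      = (\<Sum>x<p. \<Sum>k = x * q..<x * q + q. f (k div q) (k mod q))"
    by (simp add: sum.nat_group flip: lessThan_atLeast0)
  also have "\<dots> = (\<Sum>x<p. \<Sum>y = 0..<q. f ((y + x * q) div q) ((y + x * q) mod q))"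
    using sum.shift_bounds_nat_ivl[of "\<lambda>k. f (k div q) (k mod q)" 0 _ q]
    by (simp only: add_0 add.commute[of q])
  also have "\<dots> = (\<Sum>x = 0..<p. \<Sum>y = 0..<q. f x y)"
    by (intro sum.cong) auto
  finally show ?thesis .
qed

text \<open>The mixed-product rule. Commutativity moves each entry of \<open>C\<close> past one of
  \<open>B\<close>; the sum over the combined index then becomes a double sum that factors.\<close>

lemma kronecker_mult:
  fixes A B C D :: "'a::comm_semiring_0 mat"
  assumes "A \<in> carrier_mat a p" "B \<in> carrier_mat b q" "C \<in> carrier_mat p c" "D \<in> carrier_mat q d"
  shows "kronecker A B * kronecker C D = kronecker (A * C) (B * D)"
proof (rule eq_matI)
  fix i j assume "i < dim_row (kronecker (A * C) (B * D))" "j < dim_col (kronecker (A * C) (B * D))"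
  with assms have ij: "i < a * b" "j < c * d" by auto
  note bounds = div_mod_less_mult[OF ij(1)] div_mod_less_mult[OF ij(2)]
  have "(kronecker A B * kronecker C D) $$ (i, j) =
    (\<Sum>k = 0..<p * q. (A $$ (i div b, k div q) * C $$ (k div q, j div d)) *
       (B $$ (i mod b, k mod q) * D $$ (k mod q, j mod d)))"
    using assms ij by (simp add: scalar_prod_def index_kronecker ac_simps)
  also have "\<dots> = (\<Sum>x = 0..<p. \<Sum>y = 0..<q. (A $$ (i div b, x) * C $$ (x, j div d)) *
       (B $$ (i mod b, y) * D $$ (y, j mod d)))"
    by (rule sum_div_mod)
  also have "\<dots> = kronecker (A * C) (B * D) $$ (i, j)"
    using assms ij bounds by (simp add: scalar_prod_def index_kronecker sum_product)
  finally show "(kronecker A B * kronecker C D) $$ (i, j) = kronecker (A * C) (B * D) $$ (i, j)" .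
qed (use assms in auto)

lemma kronecker_transpose:
  "transpose_mat (kronecker A B) = kronecker (transpose_mat A) (transpose_mat B)"
  by (rule eq_matI) (auto simp: index_kronecker div_mod_less_mult)

lemma kronecker_adjoint:
  fixes A B :: "complex mat"
  shows "mat_adjoint (kronecker A B) = kronecker (mat_adjoint A) (mat_adjoint B)"
  by (rule eq_matI) (auto simp: index_kronecker div_mod_less_mult)

lemma kronecker_one:
  "kronecker (1\<^sub>m a) (1\<^sub>m b) = (1\<^sub>m (a * b) :: 'a::semiring_1 mat)"
proof (rule eq_matI)
  fix i j assume "i < dim_row (1\<^sub>m (a * b) :: 'a mat)" "j < dim_col (1\<^sub>m (a * b) :: 'a mat)"
  then have ij: "i < a * b" "j < a * b" by auto
  have "i = j \<longleftrightarrow> i div b = j div b \<and> i mod b = j mod b"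
    by (metis div_mult_mod_eq)
  then show "kronecker (1\<^sub>m a) (1\<^sub>m b) $$ (i, j) = (1\<^sub>m (a * b) :: 'a mat) $$ (i, j)"
    using ij div_mod_less_mult[OF ij(1)] div_mod_less_mult[OF ij(2)]
    by (auto simp: index_kronecker)
qed auto

section \<open>The exchange matrix\<close>

definition exchange_mat :: "nat \<Rightarrow> 'a::{zero, one} mat" where
  "exchange_mat n = mat n n (\<lambda>(i, j). if i + j + 1 = n then 1 else 0)"

lemma exchange_mat_carrier [simp]: "exchange_mat n \<in> carrier_mat n n"
  by (simp add: exchange_mat_def)

text \<open>Reversal acts digit by digit: with \<open>i = x * b + y\<close> and
  \<open>y < b\<close>, \<open>a * b - 1 - i = (a - 1 - x) * b + (b - 1 - y)\<close>, and no borrow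
  occurs. This is what makes reversal compatible with Kronecker products and with blocks.\<close>

lemma div_mod_reverse:
  fixes i a b :: nat
  assumes "i < a * b"
  shows "(a * b - 1 - i) div b = a - 1 - i div b" "(a * b - 1 - i) mod b = b - 1 - i mod b"
proof -
  note bounds = div_mod_less_mult[OF assms]
  have "a = (a - 1 - i div b) + i div b + 1" using bounds by linarith
  then have "a * b = (a - 1 - i div b) * b + (i div b) * b + b"
    by (metis add_mult_distrib mult_1)
  moreover have "i = (i div b) * b + i mod b" by simp
  ultimately have "a * b - 1 - i = (a - 1 - i div b) * b + (b - 1 - i mod b)"
    using bounds(2) by linarith
  moreover have "b - 1 - i mod b < b" using bounds(3) by simp
  ultimately show "(a * b - 1 - i) div b = a - 1 - i div b"
    "(a * b - 1 - i) mod b = b - 1 - i mod b"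
    by simp_all
qed

lemma kronecker_exchange:
  "kronecker (exchange_mat a) (exchange_mat b) = (exchange_mat (a * b) :: 'a::semiring_1 mat)"
proof (rule eq_matI)
  fix i j assume "i < dim_row (exchange_mat (a * b) :: 'a mat)"
    "j < dim_col (exchange_mat (a * b) :: 'a mat)"
  then have ij: "i < a * b" "j < a * b" by (auto simp: exchange_mat_def)
  note bounds = div_mod_less_mult[OF ij(1)] div_mod_less_mult[OF ij(2)]
  have "i + j + 1 = a * b \<longleftrightarrow> j = a * b - 1 - i" using ij by auto
  also have "\<dots> \<longleftrightarrow> j div b = (a * b - 1 - i) div b \<and> j mod b = (a * b - 1 - i) mod b"
    by (metis div_mult_mod_eq)
  also have "\<dots> \<longleftrightarrow> j div b = a - 1 - i div b \<and> j mod b = b - 1 - i mod b"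
    using div_mod_reverse[OF ij(1)] by simp
  also have "\<dots> \<longleftrightarrow> i div b + j div b + 1 = a \<and> i mod b + j mod b + 1 = b"
    using bounds by linarith
  finally show "kronecker (exchange_mat a) (exchange_mat b) $$ (i, j) =
      (exchange_mat (a * b) :: 'a mat) $$ (i, j)"
    using ij bounds by (auto simp: index_kronecker exchange_mat_def)
qed (auto simp: exchange_mat_def)

section \<open>The matrices \<open>U_mat n\<close>\<close>

lemma U_mat_carrier [simp]: "U_mat n \<in> carrier_mat n n"
  by (simp add: U_mat_def)

lemma dim_U_mat [simp]: "dim_row (U_mat n) = n" "dim_col (U_mat n) = n"
  by (simp_all add: U_mat_def)

definition U_diag :: "nat \<Rightarrow> nat \<Rightarrow> complex" where
  "U_diag n r = (if r < n div 2 then 1 / complex_of_real (sqrt 2)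
     else if n - 1 - r < n div 2 then - \<i> / complex_of_real (sqrt 2) else 1)"

text \<open>The middle entry for odd \<open>n\<close> lies on both diagonals. \<open>U_diag\<close>
  already assigns 1 to it, so the value here is 0 and adding the two contributions does not count it
  twice.\<close>

definition U_anti :: "nat \<Rightarrow> nat \<Rightarrow> complex" where
  "U_anti n r = (if r < n div 2 then \<i> / complex_of_real (sqrt 2)
     else if n - 1 - r < n div 2 then 1 / complex_of_real (sqrt 2) else 0)"

lemma index_U_mat:
  assumes "r < n" "c < n"
  shows "U_mat n $$ (r, c) =
    (if c = r then U_diag n r else 0) + (if c = n - 1 - r then U_anti n r else 0)"
proof -
  have "r < n div 2 \<or> n - 1 - r < n div 2 \<or> odd n \<and> r = n div 2"
    using assms by presburger
  then consider "r < n div 2" | "n - 1 - r < n div 2" | "odd n" "r = n div 2" by blast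
  then show ?thesis
    using assms by cases (auto simp: U_mat_def U_diag_def U_anti_def elim!: oddE)
qed

text \<open>Collapses the product of a row of \<open>U_mat\<close> with another row to two terms.
  The positions \<open>u\<close> and \<open>v\<close> may coincide, as they do in the middle row for
  odd \<open>n\<close>.\<close>

lemma sum_two_deltas:
  fixes f :: "nat \<Rightarrow> 'a::semiring_0"
  assumes "u < n" "v < n"
  shows "(\<Sum>k = 0..<n. ((if k = u then a else 0) + (if k = v then b else 0)) * f k) = a * f u + b * f v"
  using assms by (simp add: distrib_right sum.distrib if_distrib[of "\<lambda>x. x * _"] sum.delta cong: if_cong)

text \<open>Upper half, lower half, and the middle row of odd \<open>n\<close>, which is its own
  mirror image.\<close>

lemma row_cases:
  fixes n i :: nat
  assumes "i < n"
  obtains "i < n div 2" "n - 1 - i \<ge> n div 2" "n - 1 - i \<noteq> i"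
    | "n - 1 - i < n div 2" "i \<ge> n div 2" "n - 1 - i \<noteq> i"
    | "i \<ge> n div 2" "n - 1 - i = i"
  using assms by linarith

lemma sqrt2_square: "complex_of_real (sqrt 2) * complex_of_real (sqrt 2) = 2"
  by (simp flip: of_real_mult)

text \<open>Only opposite rows share columns. On these two columns they read (1, i) and (1, -i) over
  sqrt 2: without conjugation, each has product 0 with itself and 1 with the other.\<close>

lemma U_mat_mult_transpose: "U_mat n * transpose_mat (U_mat n) = exchange_mat n"
proof (rule eq_matI)
  fix i j assume "i < dim_row (exchange_mat n :: complex mat)"
    "j < dim_col (exchange_mat n :: complex mat)"
  then have ij: "i < n" "j < n" by (auto simp: exchange_mat_def)
  have "(U_mat n * transpose_mat (U_mat n)) $$ (i, j) =
      (\<Sum>k = 0..<n. U_mat n $$ (i, k) * U_mat n $$ (j, k))"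
    using ij by (simp add: scalar_prod_def)
  also have "\<dots> = (\<Sum>k = 0..<n. ((if k = i then U_diag n i else 0) +
      (if k = n - 1 - i then U_anti n i else 0)) * U_mat n $$ (j, k))"
    using ij by (intro sum.cong) (auto simp: index_U_mat)
  also have "\<dots> = U_diag n i * U_mat n $$ (j, i) + U_anti n i * U_mat n $$ (j, n - 1 - i)"
    using ij by (intro sum_two_deltas) auto
  also have "\<dots> = exchange_mat n $$ (i, j)"
    using ij(1) by (cases rule: row_cases)
      (use ij in \<open>auto simp: index_U_mat U_diag_def U_anti_def exchange_mat_def sqrt2_square\<close>)
  finally show "(U_mat n * transpose_mat (U_mat n)) $$ (i, j) = exchange_mat n $$ (i, j)" .
qed (auto simp: exchange_mat_def)

text \<open>The same computation with conjugation makes (1, i) and (1, -i) over sqrt 2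
  orthonormal.\<close>

lemma U_mat_mult_adjoint: "U_mat n * mat_adjoint (U_mat n) = 1\<^sub>m n"
proof (rule eq_matI)
  fix i j assume "i < dim_row (1\<^sub>m n :: complex mat)" "j < dim_col (1\<^sub>m n :: complex mat)"
  then have ij: "i < n" "j < n" by auto
  have "(U_mat n * mat_adjoint (U_mat n)) $$ (i, j) =
      (\<Sum>k = 0..<n. U_mat n $$ (i, k) * cnj (U_mat n $$ (j, k)))"
    using ij by (simp add: scalar_prod_def)
  also have "\<dots> = (\<Sum>k = 0..<n. ((if k = i then U_diag n i else 0) +
      (if k = n - 1 - i then U_anti n i else 0)) * cnj (U_mat n $$ (j, k)))"
    using ij by (intro sum.cong) (auto simp: index_U_mat)
  also have "\<dots> = U_diag n i * cnj (U_mat n $$ (j, i)) + U_anti n i * cnj (U_mat n $$ (j, n - 1 - i))"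
    using ij by (intro sum_two_deltas) auto
  also have "\<dots> = 1\<^sub>m n $$ (i, j)"
    using ij(1) by (cases rule: row_cases)
      (use ij in \<open>auto simp: index_U_mat U_diag_def U_anti_def sqrt2_square\<close>)
  finally show "(U_mat n * mat_adjoint (U_mat n)) $$ (i, j) = 1\<^sub>m n $$ (i, j)" .
qed auto

section \<open>The product of the factors as a Kronecker product\<close>

lemma total_size_Suc: "total_size n (Suc k) = n (Suc k) * total_size n k"
  by (simp add: total_size_def mult.commute)

lemma U_factor_Suc:
  "U_factor n (Suc p) i =
    kronecker (if Suc p = i then U_mat (n (Suc p)) else 1\<^sub>m (n (Suc p))) (U_factor n p i)"
  by (simp add: U_factor_def)

lemma U_factor_carrier: "U_factor n p i \<in> carrier_mat (total_size n p) (total_size n p)"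
proof (induction p)
  case 0
  then show ?case by (simp add: U_factor_def total_size_def)
next
  case (Suc p)
  then show ?case unfolding U_factor_Suc total_size_Suc by (intro kronecker_carrier) auto
qed

text \<open>No level up to \<open>p\<close> equals \<open>i\<close>, so every Kronecker factor is an
  identity. The case \<open>i = Suc p\<close> describes the lower levels of the last factor of
  \<open>U_total n (Suc p)\<close>.\<close>

lemma U_factor_above: "p < i \<Longrightarrow> U_factor n p i = 1\<^sub>m (total_size n p)"
proof (induction p)
  case 0
  then show ?case by (simp add: U_factor_def total_size_def)
next
  case (Suc p)
  then show ?case by (simp add: U_factor_Suc total_size_Suc kronecker_one)
qed

lemma foldr_mult_carrier:
  "(\<And>i. F i \<in> carrier_mat s s) \<Longrightarrow> B \<in> carrier_mat s s \<Longrightarrow>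
    foldr (*) (map F xs) B \<in> carrier_mat s s"
  by (induction xs) (auto intro!: mult_carrier_mat)

text \<open>Each factor is the identity in the left slot, so by the mixed-product rule it leaves
  \<open>A\<close> alone and multiplies only the right slot.\<close>

lemma foldr_mult_kronecker:
  fixes A B :: "'a::comm_semiring_1 mat"
  assumes "A \<in> carrier_mat m m" "B \<in> carrier_mat s s" "\<And>i. F i \<in> carrier_mat s s"
  shows "foldr (*) (map (\<lambda>i. kronecker (1\<^sub>m m) (F i)) xs) (kronecker A B) =
    kronecker A (foldr (*) (map F xs) B)"
proof (induction xs)
  case (Cons x xs)
  have "foldr (*) (map F xs) B \<in> carrier_mat s s"
    using assms by (intro foldr_mult_carrier)
  with Cons assms show ?case
    by (simp add: kronecker_mult[of _ m m _ s s _ m _ s])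
qed simp

lemma U_total_carrier: "U_total n p \<in> carrier_mat (total_size n p) (total_size n p)"
  unfolding U_total_def by (intro foldr_mult_carrier U_factor_carrier) auto

text \<open>The factors for levels up to \<open>p\<close> are the identity in the leading slot, and
  the last one is the identity in all other slots. This recursion lets the identities for
  \<open>U_mat\<close> pass to \<open>U_total\<close> by induction.\<close>

lemma U_total_Suc: "U_total n (Suc p) = kronecker (U_mat (n (Suc p))) (U_total n p)"
proof -
  let ?m = "n (Suc p)" and ?s = "total_size n p"
  have last: "U_factor n (Suc p) (Suc p) = kronecker (U_mat ?m) (1\<^sub>m ?s)"
    by (simp add: U_factor_Suc U_factor_above)
  have split: "[1..<Suc (Suc p)] = [1..<Suc p] @ [Suc p]" by simp
  have init: "map (U_factor n (Suc p)) [1..<Suc p] =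
      map (\<lambda>i. kronecker (1\<^sub>m ?m) (U_factor n p i)) [1..<Suc p]"
    by (intro map_cong) (auto simp: U_factor_Suc)
  have "U_total n (Suc p) = foldr (*) (map (\<lambda>i. kronecker (1\<^sub>m ?m) (U_factor n p i)) [1..<Suc p])
      (kronecker (U_mat ?m) (1\<^sub>m ?s))"
    \<comment> \<open>The final identity matrix is absorbed into the last factor, which thereby
      becomes the start value of the fold.\<close>
    using last right_mult_one_mat[OF U_factor_carrier[of n "Suc p" "Suc p"]]
    unfolding U_total_def split map_append init foldr_append by simp
  also have "\<dots> = kronecker (U_mat ?m) (foldr (*) (map (U_factor n p) [1..<Suc p]) (1\<^sub>m ?s))"
    by (rule foldr_mult_kronecker) (auto simp: U_factor_carrier)
  finally show ?thesis by (simp add: U_total_def)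
qed

lemma U_total_mult_transpose:
  "U_total n p * transpose_mat (U_total n p) = exchange_mat (total_size n p)"
proof (induction p)
  case 0
  show ?case by (rule eq_matI) (auto simp: U_total_def total_size_def exchange_mat_def)
next
  case (Suc p)
  let ?m = "n (Suc p)" and ?s = "total_size n p"
  have "U_total n (Suc p) * transpose_mat (U_total n (Suc p)) =
      kronecker (U_mat ?m * transpose_mat (U_mat ?m)) (U_total n p * transpose_mat (U_total n p))"
    unfolding U_total_Suc kronecker_transpose
    by (rule kronecker_mult[of _ ?m ?m _ ?s ?s _ ?m _ ?s]) (use U_total_carrier in auto)
  then show ?case
    by (simp add: Suc U_mat_mult_transpose kronecker_exchange total_size_Suc)
qed

lemma mat_adjoint_carrier [simp]: "A \<in> carrier_mat a b \<Longrightarrow> mat_adjoint A \<in> carrier_mat b a"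
  by auto

lemma U_total_mult_adjoint:
  "U_total n p * mat_adjoint (U_total n p) = 1\<^sub>m (total_size n p)"
proof (induction p)
  case 0
  show ?case by (rule eq_matI) (auto simp: U_total_def total_size_def scalar_prod_def)
next
  case (Suc p)
  let ?m = "n (Suc p)" and ?s = "total_size n p"
  have "U_total n (Suc p) * mat_adjoint (U_total n (Suc p)) =
      kronecker (U_mat ?m * mat_adjoint (U_mat ?m)) (U_total n p * mat_adjoint (U_total n p))"
    unfolding U_total_Suc kronecker_adjoint
    by (rule kronecker_mult[of _ ?m ?m _ ?s ?s _ ?m _ ?s])
      (use U_total_carrier in \<open>auto intro!: mat_adjoint_carrier\<close>)
  then show ?case
    by (simp add: Suc U_mat_mult_adjoint kronecker_one total_size_Suc)
qed

text \<open>For square matrices the right inverse found above is also a left inverse.\<close>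

lemma unitary_U_total: "unitary_mat (total_size n p) (U_total n p)"
  unfolding unitary_mat_def
  using U_total_carrier[of n p] U_total_mult_adjoint[of n p]
    mat_mult_left_right_inverse[OF U_total_carrier mat_adjoint_carrier[OF U_total_carrier]
      U_total_mult_adjoint, of n p]
  by blast

section \<open>Persymmetry of multilevel Toeplitz matrices\<close>

lemma multilevel_toeplitz_carrier:
  "multilevel_toeplitz n k A \<Longrightarrow> A \<in> carrier_mat (total_size n k) (total_size n k)"
  by (cases k) (auto simp: total_size_def)

text \<open>Reversing both indices and swapping them preserves the difference of their digits at
  every level. The induction treats the outermost digit as the block index and leaves the remainders
  to the hypothesis for the block.\<close>

lemma multilevel_toeplitz_persymmetric:
  assumes "multilevel_toeplitz n k A" "r < total_size n k" "c < total_size n k"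
  shows "A $$ (total_size n k - 1 - c, total_size n k - 1 - r) = A $$ (r, c)"
  using assms
proof (induction k arbitrary: A r c)
  case 0
  then show ?case by (simp add: total_size_def)
next
  case (Suc k)
  let ?b = "total_size n k" and ?m = "n (Suc k)"
  obtain T where T: "\<And>l. \<bar>l\<bar> \<le> int ?m - 1 \<Longrightarrow> multilevel_toeplitz n k (T l)"
    and block: "\<And>i j. i < ?m \<Longrightarrow> j < ?m \<Longrightarrow> mat_block ?b A i j = T (int i - int j)"
    using Suc.prems(1) by auto
  have rc: "r < ?m * ?b" "c < ?m * ?b"
    using Suc.prems(2,3) by (simp_all add: total_size_Suc)
  have entry: "A $$ (r, c) = T (int (r div ?b) - int (c div ?b)) $$ (r mod ?b, c mod ?b)"
    if "r < ?m * ?b" "c < ?m * ?b" for r c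
    using div_mod_less_mult[OF that(1)] div_mod_less_mult[OF that(2)]
    by (simp add: mat_block_def div_mult_mod_eq flip: block)
  note bounds = div_mod_less_mult[OF rc(1)] div_mod_less_mult[OF rc(2)]
  let ?l = "int (r div ?b) - int (c div ?b)"
  \<comment> \<open>The reversed and swapped position therefore lies in a copy of the same block
    \<open>T ?l\<close>.\<close>
  have "int (?m - 1 - c div ?b) - int (?m - 1 - r div ?b) = ?l"
    using bounds by linarith
  then have "A $$ (?m * ?b - 1 - c, ?m * ?b - 1 - r) =
      T ?l $$ (?b - 1 - c mod ?b, ?b - 1 - r mod ?b)"
    using rc bounds by (subst entry) (auto simp only: div_mod_reverse)
  \<comment> \<open>Both block indices are below \<open>?m\<close>, so \<open>?l\<close> is in the
    range where \<open>T\<close> is known to be Toeplitz.\<close>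
  also have "\<dots> = T ?l $$ (r mod ?b, c mod ?b)"
    using bounds by (intro Suc.IH T) linarith+
  also have "\<dots> = A $$ (r, c)"
    using entry rc by simp
  finally show ?case by (simp add: total_size_Suc)
qed

lemma exchange_mat_transpose_commute:
  fixes A :: "'a::comm_semiring_1 mat"
  assumes A: "A \<in> carrier_mat s s"
    and "\<And>r c. r < s \<Longrightarrow> c < s \<Longrightarrow> A $$ (s - 1 - c, s - 1 - r) = A $$ (r, c)"
  shows "exchange_mat s * transpose_mat A = A * exchange_mat s"
proof (rule eq_matI)
  fix i j assume "i < dim_row (A * exchange_mat s)" "j < dim_col (A * exchange_mat s)"
  with A have ij: "i < s" "j < s" by (auto simp: exchange_mat_def)
  have "(exchange_mat s * transpose_mat A) $$ (i, j) =
      (\<Sum>k = 0..<s. if k = s - 1 - i then A $$ (j, k) else 0)"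
    \<comment> \<open>Without the delta rules both sides remain sums, so \<open>sum.cong\<close> can
      compare them termwise.\<close>
    using A ij by (auto simp: scalar_prod_def exchange_mat_def simp del: sum.delta sum.delta' intro!: sum.cong)
  also have "\<dots> = A $$ (j, s - 1 - i)" using ij by simp
  \<comment> \<open>Persymmetry at row \<open>i\<close> and column \<open>s - 1 - j\<close>, whose
    reversal is \<open>j\<close>.\<close>
  also have "\<dots> = A $$ (i, s - 1 - j)"
    using assms(2)[of i "s - 1 - j"] ij by simp
  also have "\<dots> = (\<Sum>k = 0..<s. if k = s - 1 - j then A $$ (i, k) else 0)" using ij by simp
  also have "\<dots> = (A * exchange_mat s) $$ (i, j)"
    using A ij by (auto simp: scalar_prod_def exchange_mat_def simp del: sum.delta sum.delta' intro!: sum.cong)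
  finally show "(exchange_mat s * transpose_mat A) $$ (i, j) = (A * exchange_mat s) $$ (i, j)" .
qed (use A in \<open>auto simp: exchange_mat_def\<close>)

section \<open>Symmetry of the transformed matrix\<close>

lemma symmetric_mat_unitary_conjugate:
  assumes U: "unitary_mat s U" and T: "T \<in> carrier_mat s s"
    and comm: "U * transpose_mat U * transpose_mat T = T * (U * transpose_mat U)"
  shows "symmetric_mat (mat_adjoint U * T * U)"
proof -
  let ?V = "mat_adjoint U"
  have Uc: "U \<in> carrier_mat s s" and VU: "?V * U = 1\<^sub>m s"
    using U by (auto simp: unitary_mat_def)
  then have [simp]: "U \<in> carrier_mat s s" "?V \<in> carrier_mat s s"
    "transpose_mat U \<in> carrier_mat s s" "transpose_mat ?V \<in> carrier_mat s s"
    "transpose_mat T \<in> carrier_mat s s" "T \<in> carrier_mat s s"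
    using T by auto
  note [simp] = mult_carrier_mat[of _ s s _ s]
  note assoc = assoc_mult_mat[of _ s s _ s _ s]
  have UtVt: "transpose_mat U * transpose_mat ?V = 1\<^sub>m s"
    using VU by (simp flip: transpose_mult[of _ s s _ s])
  have "transpose_mat (?V * T * U) = transpose_mat U * (transpose_mat T * transpose_mat ?V)"
    by (simp add: transpose_mult[of _ s s _ s])
  \<comment> \<open>Inserting the identity as \<open>?V * U\<close> creates the product
    \<open>U * transpose_mat U * transpose_mat T\<close> to which \<open>comm\<close>
    applies.\<close>
  also have "\<dots> = ?V * U * (transpose_mat U * (transpose_mat T * transpose_mat ?V))"
    by (simp add: VU left_mult_one_mat[of _ s s])
  also have "\<dots> = ?V * (U * transpose_mat U * transpose_mat T) * transpose_mat ?V"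
    by (simp add: assoc)
  also have "\<dots> = ?V * T * U * (transpose_mat U * transpose_mat ?V)"
    unfolding comm by (simp add: assoc)
  also have "\<dots> = ?V * T * U"
    by (simp add: UtVt right_mult_one_mat[of _ s s])
  finally show ?thesis by (simp add: symmetric_mat_def)
qed

theorem theorem3p1:
  fixes p :: nat and n :: "nat \<Rightarrow> nat" and T :: "complex mat"
  assumes "p \<ge> 1"
    and "\<And>i. 1 \<le> i \<Longrightarrow> i \<le> p \<Longrightarrow> n i > 0"
    and "multilevel_toeplitz n p T"
  shows "unitary_mat (total_size n p) (U_total n p) \<and>
         symmetric_mat (mat_adjoint (U_total n p) * T * U_total n p)"
proof
  show "unitary_mat (total_size n p) (U_total n p)" by (rule unitary_U_total)
  show "symmetric_mat (mat_adjoint (U_total n p) * T * U_total n p)"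
    \<comment> \<open>\<open>U_total_mult_transpose\<close> turns the commutation condition on
      \<open>U_total\<close> into the one for the exchange matrix, which persymmetry
      supplies.\<close>
    using symmetric_mat_unitary_conjugate[OF unitary_U_total multilevel_toeplitz_carrier[OF assms(3)]]
      exchange_mat_transpose_commute[OF multilevel_toeplitz_carrier multilevel_toeplitz_persymmetric]
      assms(3)
    by (simp add: U_total_mult_transpose)
qed

end
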